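(* There exist a set algebra $(J,\mathcal{B})$ and a bounded submodular set function $\psi\colon\mathcal{B}\to\mathbb{R}$ with $\psi(\emptyset)=0$ that does not admit a monotonic sum-decomposition.
   Context: A set algebra $(J,\mathcal{B})$ is a set $J$ with a family $\mathcal{B}$ of subsets of $J$ closed under complements and finite unions. A set function $\varphi\colon\mathcal{B}\to\mathbb{R}$ is increasing (decreasing) if $X\subseteq Y$ implies $\varphi(X)\le\varphi(Y)$ (respectively $\varphi(X)\ge\varphi(Y)$), bounded if there is $b\in\mathbb{R}$ with $-b\le\varphi(X)\le b$ for all $X\in\mathcal{B}$, and submodular if $\varphi(X)+\varphi(Y)\ge\varphi(X\cap Y)+\varphi(X\cup Y)$ for all $X,Y\in\mathcal{B}$. A monotonic sum-decomposition of $\varphi$ (with $\varphi(\emptyset)=0$) is an expression $\varphi=\varphi_1+\varphi_2$ with $\varphi_1,\varphi_2\colon\mathcal{B}\to\mathbb{R}$ submodular, $\varphi_1$ increasing, $\varphi_2$ decreasing, and $\varphi_1(\emptyset)=\varphi_2(\emptyset)=0$. *)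

theory Defs
  imports "HOL-Analysis.Analysis"
begin

text \<open>
  A real-valued set function on a family \<open>B\<close> of subsets of a type is represented by a total
  function on all subsets; its values outside \<open>B\<close> are irrelevant, so every property below is
  relativised to \<open>B\<close>. These definitions are meant for a family \<open>B\<close> that is a set algebra, in
  the sense of the library predicate \<^const>\<open>algebra\<close>.
\<close>

definition submodular_on :: "'a set set \<Rightarrow> ('a set \<Rightarrow> real) \<Rightarrow> bool" where
  "submodular_on B \<phi> \<longleftrightarrow>
     (\<forall>X\<in>B. \<forall>Y\<in>B. \<phi> X + \<phi> Y \<ge> \<phi> (X \<inter> Y) + \<phi> (X \<union> Y))"

definition monotonic_sum_decomposition ::
    "'a set set \<Rightarrow> ('a set \<Rightarrow> real) \<Rightarrow> ('a set \<Rightarrow> real) \<Rightarrow> ('a set \<Rightarrow> real) \<Rightarrow> bool" where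
  "monotonic_sum_decomposition B \<phi> \<phi>1 \<phi>2 \<longleftrightarrow>
     (\<forall>X\<in>B. \<phi> X = \<phi>1 X + \<phi>2 X) \<and>
     submodular_on B \<phi>1 \<and> submodular_on B \<phi>2 \<and>
     mono_on B \<phi>1 \<and> antimono_on B \<phi>2 \<and>
     \<phi>1 {} = 0 \<and> \<phi>2 {} = 0"

end

theory Submission
  imports Defs
begin

text \<open>
  Fix a set \<open>J\<close> with disjoint infinite subsets \<open>A\<close> and \<open>B\<close>; for \<open>X \<subseteq> J\<close>, let \<open>\<psi> X\<close> be 1
  if \<open>X\<close> meets \<open>A\<close> without containing \<open>B\<close>, and 0 otherwise. Suppose that \<open>\<psi> = \<phi>1 + \<phi>2\<close> is a monotonic sum-decomposition.
  Look at the loss \<open>p a\<close> of \<open>\<phi>2\<close> when \<open>a \<in> A\<close> is added to \<open>B\<close>, and at the loss \<open>q b\<close> of \<open>\<phi>1\<close>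
  when \<open>b \<in> B\<close> is removed from \<open>B\<close>. For the four sets obtained from \<open>B\<close> by possibly adding \<open>a\<close>
  and possibly removing \<open>b\<close>, the value of \<open>\<psi>\<close> is 1 if both are done and 0 otherwise; monotonicity
  of \<open>\<phi>1\<close> and \<open>\<phi>2\<close> then forces \<open>p a + q b \<ge> 1\<close>. So either every \<open>p a\<close> or every \<open>q b\<close> is at least
  1/2.

  Submodularity adds such losses up: adding \<open>n\<close> elements of \<open>A\<close> to \<open>B\<close> lowers \<open>\<phi>2\<close> by at least the
  sum of the \<open>n\<close> losses \<open>p a\<close>, and removing \<open>n\<close> elements of \<open>B\<close> from \<open>B\<close> lowers \<open>\<phi>1\<close> by at least
  the sum of the \<open>n\<close> losses \<open>q b\<close>. A monotone real-valued function on all subsets of \<open>J\<close> is bounded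
  by its values at \<open>{}\<close> and \<open>J\<close>, so neither sum can exceed a bound that does not depend
  on \<open>n\<close>; but one of them is at least \<open>n / 2\<close>.

  On finite \<open>A\<close> and \<open>B\<close> decompositions do exist, but the same count shows that the summands must be
  large compared with \<open>\<psi>\<close>; that is what fails in the limit.
\<close>

definition meets_without_covering :: "'a set \<Rightarrow> 'a set \<Rightarrow> 'a set \<Rightarrow> real" where
  "meets_without_covering A B X = (if X \<inter> A \<noteq> {} \<and> \<not> B \<subseteq> X then 1 else 0)"

text \<open>
  Each of the conditions \<open>X \<inter> A = {}\<close> and \<open>B \<subseteq> X\<close> is closed under unions and intersections, the
  first one passes to subsets and the second one to supersets. So if one of \<open>X\<close>, \<open>Y\<close> has value 0,
  then so has their union or their intersection, and if both have value 0, then both do.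
\<close>

lemma submodular_on_meets_without_covering:
  "submodular_on \<B> (meets_without_covering A B)"
  unfolding submodular_on_def meets_without_covering_def by auto

text \<open>The marginal values of a submodular function at \<open>C\<close> dominate those at supersets of \<open>C\<close>.\<close>

lemma submodular_on_gain_le_sum_gains:
  assumes sub: "submodular_on (Pow J) \<phi>" and "finite F" "F \<subseteq> J" "C \<subseteq> J"
  shows "\<phi> (C \<union> F) - \<phi> C \<le> (\<Sum>x\<in>F. \<phi> (insert x C) - \<phi> C)"
  using assms(2,3)
proof (induction F rule: finite_induct)
  case empty
  then show ?case by simp
next
  case (insert x F)
  have "(C \<union> F) \<inter> insert x C = C" and "(C \<union> F) \<union> insert x C = C \<union> insert x F"
    using insert.hyps by auto
  moreover have "C \<union> F \<in> Pow J" "insert x C \<in> Pow J"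
    using insert.prems \<open>C \<subseteq> J\<close> by auto
  ultimately have "\<phi> (C \<union> insert x F) + \<phi> C \<le> \<phi> (C \<union> F) + \<phi> (insert x C)"
    using sub[unfolded submodular_on_def, rule_format, of "C \<union> F" "insert x C"] by simp
  with insert show ?case by simp
qed

text \<open>The same domination read downwards: marginal values grow as elements are removed from \<open>C\<close>.\<close>

lemma submodular_on_sum_losses_le_loss:
  assumes sub: "submodular_on (Pow J) \<phi>" and "finite F" "F \<subseteq> C" "C \<subseteq> J"
  shows "(\<Sum>x\<in>F. \<phi> C - \<phi> (C - {x})) \<le> \<phi> C - \<phi> (C - F)"
  using assms(2,3)
proof (induction F rule: finite_induct)
  case empty
  then show ?case by simp
next
  case (insert x F)
  have "(C - F) \<inter> (C - {x}) = C - insert x F" and "(C - F) \<union> (C - {x}) = C"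
    using insert.hyps by auto
  moreover have "C - F \<in> Pow J" "C - {x} \<in> Pow J"
    using \<open>C \<subseteq> J\<close> by auto
  ultimately have "\<phi> (C - insert x F) + \<phi> C \<le> \<phi> (C - F) + \<phi> (C - {x})"
    using sub[unfolded submodular_on_def, rule_format, of "C - F" "C - {x}"] by simp
  with insert show ?case by simp
qed

lemma infinite_finite_sums_unbounded:
  fixes f :: "'a \<Rightarrow> real"
  assumes "infinite S" "0 < \<epsilon>" and large: "\<And>x. x \<in> S \<Longrightarrow> \<epsilon> \<le> f x"
  obtains F where "finite F" "F \<subseteq> S" "M < sum f F"
proof -
  obtain n :: nat where n: "M < of_nat n * \<epsilon>"
    using ex_less_of_nat_mult[OF \<open>0 < \<epsilon>\<close>] by blast
  obtain F where F: "finite F" "card F = n" "F \<subseteq> S"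
    using infinite_arbitrarily_large[OF \<open>infinite S\<close>] by blast
  have "of_nat (card F) * \<epsilon> \<le> sum f F"
    using F large by (intro sum_bounded_below) auto
  with n F show ?thesis by (intro that[of F]) auto
qed

lemma meets_without_covering_no_decomposition:
  assumes "infinite A" "infinite B" and disj: "A \<inter> B = {}" and AJ: "A \<subseteq> J" and BJ: "B \<subseteq> J"
  shows "\<not> monotonic_sum_decomposition (Pow J) (meets_without_covering A B) \<phi>1 \<phi>2"
proof
  let ?\<psi> = "meets_without_covering A B"
  assume "monotonic_sum_decomposition (Pow J) ?\<psi> \<phi>1 \<phi>2"
  then have split: "X \<subseteq> J \<Longrightarrow> ?\<psi> X = \<phi>1 X + \<phi>2 X"
    and sub: "submodular_on (Pow J) \<phi>1" "submodular_on (Pow J) \<phi>2"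
    and inc: "X \<subseteq> Y \<Longrightarrow> Y \<subseteq> J \<Longrightarrow> \<phi>1 X \<le> \<phi>1 Y"
    and dec: "X \<subseteq> Y \<Longrightarrow> Y \<subseteq> J \<Longrightarrow> \<phi>2 Y \<le> \<phi>2 X" for X Y
    unfolding monotonic_sum_decomposition_def monotone_on_def
    by auto
  define p where "p a = \<phi>2 B - \<phi>2 (insert a B)" for a
  define q where "q b = \<phi>1 B - \<phi>1 (B - {b})" for b
  have pq: "1 \<le> p a + q b" if "a \<in> A" "b \<in> B" for a b
  proof -
    have sets: "insert a B \<subseteq> J" "B - {b} \<subseteq> J" "insert a (B - {b}) \<subseteq> J"
      using that AJ BJ by auto
    have "?\<psi> B = 0" "?\<psi> (insert a B) = 0" "?\<psi> (B - {b}) = 0" "?\<psi> (insert a (B - {b})) = 1"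
      using that disj unfolding meets_without_covering_def by auto
    moreover have "\<phi>1 (insert a (B - {b})) \<le> \<phi>1 (insert a B)"
      using sets by (intro inc) auto
    moreover have "\<phi>2 (insert a (B - {b})) \<le> \<phi>2 (B - {b})"
      using sets by (intro dec) auto
    ultimately show ?thesis
      using split[OF BJ] split[OF sets(1)] split[OF sets(2)] split[OF sets(3)]
      unfolding p_def q_def by linarith
  qed
  have "1/2 \<le> q b" if "a \<in> A" "\<not> 1/2 \<le> p a" "b \<in> B" for a b
    using pq[of a b] that by simp
  then consider "\<And>a. a \<in> A \<Longrightarrow> 1/2 \<le> p a" | "\<And>b. b \<in> B \<Longrightarrow> 1/2 \<le> q b"
    by blast
  then show False
  proof cases
    case 1
    obtain F where F: "finite F" "F \<subseteq> A" and big: "\<phi>2 B - \<phi>2 J < sum p F"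
      by (rule infinite_finite_sums_unbounded[OF \<open>infinite A\<close> half_gt_zero[OF zero_less_one] 1])
    have "\<phi>2 (B \<union> F) - \<phi>2 B \<le> (\<Sum>x\<in>F. \<phi>2 (insert x B) - \<phi>2 B)"
      using F AJ BJ by (intro submodular_on_gain_le_sum_gains[OF sub(2)]) auto
    then have "sum p F \<le> \<phi>2 B - \<phi>2 (B \<union> F)"
      unfolding p_def by (simp add: sum_subtractf)
    moreover have "\<phi>2 J \<le> \<phi>2 (B \<union> F)"
      using F AJ BJ by (intro dec) auto
    ultimately show False using big by linarith
  next
    case 2
    obtain F where F: "finite F" "F \<subseteq> B" and big: "\<phi>1 B - \<phi>1 {} < sum q F"
      by (rule infinite_finite_sums_unbounded[OF \<open>infinite B\<close> half_gt_zero[OF zero_less_one] 2])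
    have "sum q F \<le> \<phi>1 B - \<phi>1 (B - F)"
      unfolding q_def by (rule submodular_on_sum_losses_le_loss[OF sub(1) F BJ])
    moreover have "\<phi>1 {} \<le> \<phi>1 (B - F)"
      using BJ by (intro inc) auto
    ultimately show False using big by linarith
  qed
qed

theorem corollary5p8:
  "\<exists>(J :: nat set) (B :: nat set set) (\<psi> :: nat set \<Rightarrow> real).
     algebra J B \<and> submodular_on B \<psi> \<and> bounded (\<psi> ` B) \<and> \<psi> {} = 0 \<and>
     \<not> (\<exists>\<phi>1 \<phi>2. monotonic_sum_decomposition B \<psi> \<phi>1 \<phi>2)"
proof -
  let ?\<psi> = "meets_without_covering {n::nat. even n} {n. odd n}"
  have "infinite (range (\<lambda>n::nat. 2 * n))" "infinite (range (\<lambda>n::nat. 2 * n + 1))"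
    by (auto intro!: range_inj_infinite injI)
  moreover have "range (\<lambda>n::nat. 2 * n) \<subseteq> {n. even n}" "range (\<lambda>n::nat. 2 * n + 1) \<subseteq> {n. odd n}"
    by auto
  ultimately have "infinite {n::nat. even n}" "infinite {n::nat. odd n}"
    by (auto dest: infinite_super)
  then have "\<not> (\<exists>\<phi>1 \<phi>2. monotonic_sum_decomposition (Pow UNIV) ?\<psi> \<phi>1 \<phi>2)"
    using meets_without_covering_no_decomposition[of "{n::nat. even n}" "{n. odd n}" UNIV]
    by auto
  moreover have "algebra UNIV (Pow (UNIV :: nat set))"
    by (rule algebra_Pow)
  moreover have "bounded (?\<psi> ` Pow UNIV)"
    by (rule boundedI[of _ 1]) (auto simp: meets_without_covering_def)
  moreover have "?\<psi> {} = 0"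
    by (simp add: meets_without_covering_def)
  ultimately show ?thesis
    using submodular_on_meets_without_covering by blast
qed

end
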